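(* Consider the actual platoon (AP), reference platoon (RP) and virtual platoon (VP) with the adaptive control laws described in the context, with $\|\tilde x_j(0)\|_{P_m}<c$ for all $j\in\alpha_N$, $\|\tilde{\underline x}_0(0)\|_{P_{m,0}}<c$, and with bounded VP state trajectories $x_{v,j}$, $j\in\alpha_N\cup\{0\}$. Then the RP asymptotically converges to the VP, i.e. $\lim_{t\to\infty}\bar z(t)=0$, where $\bar z=\bar x_v-\bar x_r$, $\bar x_v=(x_{v,0}^T,\dots,x_{v,N}^T)^T$, $\bar x_r=(x_{r,0}^T,\dots,x_{r,N}^T)^T$. Hence the AP also asymptotically converges to the VP: $\lim_{t\to\infty}(x_j(t)-x_{v,j}(t))=0$ for all $j\in\alpha_N$.
   Context: Notation: $\|\eta\|_M=\sqrt{\eta^TM\eta}$ for $M=M^T>0$. $N\ge1$, $\alpha_N=\{1,\dots,N\}$; index $0$ is the leader. Constants $h,k_p,k_d,\bar\tau>0$ with $k_d>\bar\tau k_p$; $c>0$ is a user-chosen constant; $u_{in}:[0,\infty)\to\mathbb R$ is a bounded input. For $j\in\alpha_N\cup\{0\}$, $\tau_j>0,\Lambda_j>0$ are unknown constants, $\theta_j=\Lambda_j/\tau_j$. Barrier function: $\psi(r)=\frac{r^2}{c-r}$ for $0\le r<c$, and $\psi'(r)=\frac{d\psi}{d(r^2)}=\frac{2c-r}{2(c-r)^2}$. Matrices: $$A_m=\begin{bmatrix}0&-1&-h&0\\0&0&1&0\\0&0&-1/\bar\tau&1/\bar\tau\\k_p/h&-k_d/h&-k_d&-1/h\end{bmatrix},\quad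 A_j=\begin{bmatrix}0&-1&-h&0\\0&0&1&0\\0&0&-1/\tau_j&\Lambda_j/\tau_j\\k_p/h&-k_d/h&-k_d&-1/h\end{bmatrix},\quad B_w=\begin{bmatrix}1&0\\0&0\\0&0\\k_d/h&1/h\end{bmatrix},\quad B_u=\begin{bmatrix}0\\0\\1\\0\end{bmatrix}.$$ Followers ($j\in\alpha_N$), with states $x_j=(e_j,v_j,a_j,u_{bl,j})^T$, $x_{r,j}=(e_{r,j},v_{r,j},a_{r,j},u_{bl,r,j})^T$, $x_{v,j}=(e_{v,j},v_{v,j},a_{v,j},u_{bl,v,j})^T$ and signals $w_{j}=(v_{j},u_{bl,j})^T$, $w_{v,j}=(v_{v,j},u_{bl,v,j})^T$: - AP: $\dot x_j=A_jx_j+B_ww_{j-1}+B_u\theta_ju_{ad,j}$; - RP: $\dot x_{r,j}=A_mx_{r,j}+B_ww_{j-1}$ (driven by the AP signal $w_{j-1}$), $x_{r,j}(0)=x_{v,j}(0)$; - VP: $\dot x_{v,j}=A_mx_{v,j}+B_ww_{v,j-1}$. Leaders, with $\underline x_0=(v_0,a_0,u_{bl,0})^T$, $\underline x_{r,0}=(v_{r,0},a_{r,0},u_{bl,r,0})^T$, $\underline x_{v,0}=(v_{v,0},a_{v,0},u_{bl,v,0})^T$; the full leader states $x_0,x_{r,0},x_{v,0}\in\mathbb R^4$ are obtained by prepending a fictitious spacing error identically equal to $0$: - VP and RP leaders coincide, $\underline x_{r,0}(t)=\underline x_{v,0}(t)$ for all $t\ge0$, and satisfy $\dot{\underline x}_{r,0}=\underline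 A_{m,0}\underline x_{r,0}+\underline B_ru_{in}$, $\underline A_{m,0}=\begin{bmatrix}0&1&0\\0&-1/\bar\tau&1/\bar\tau\\0&0&-1/h\end{bmatrix}$, $\underline B_r=(0,0,1/h)^T$; - AP leader: $\dot{\underline x}_0=\underline A_0\underline x_0+\underline B_u\theta_0u_{ad,0}+\underline B_ru_{in}$, $\underline A_0=\begin{bmatrix}0&1&0\\0&-1/\tau_0&\Lambda_0/\tau_0\\0&0&-1/h\end{bmatrix}$, $\underline B_u=(0,1,0)^T$. Adaptive laws: $\tilde x_j=x_j-x_{r,j}$, $u_{ad,j}=\hat k_{x,j}^Tx_j$, $\dot{\hat k}_{x,j}=-\Gamma_{x,j}\psi'(\|\tilde x_j\|_{P_m})x_j\tilde x_j^TP_mB_u$ for $j\in\alpha_N$, where $A_m^TP_m+P_mA_m=-Q_m$ with $P_m=P_m^T>0$, $Q_m=Q_m^T>0$. For the leader, $\tilde{\underline x}_0=\underline x_0-\underline x_{r,0}$, $u_{ad,0}=\hat k_{\underline x_0}^T\underline x_0+\hat k_{\tilde{\underline x}_0}^T\tilde{\underline x}_0$, $\dot{\hat k}_{\underline x_0}=-\Gamma_{\underline x_0}\psi'(\|\tilde{\underline x}_0\|_{P_{m,0}})\underline x_0\tilde{\underline x}_0^TP_{m,0}\underline B_u$, $\dot{\hat k}_{\tilde{\underline x}_0}=-\Gamma_{\tilde{\underline x}_0}\psi'(\|\tilde{\underline x}_0\|_{P_{m,0}})\tilde{\underline x}_0\tilde{\underline x}_0^TP_{m,0}\underline B_u$,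 where $\underline A_c=\begin{bmatrix}0&1&0\\\alpha_1&\alpha_2&\alpha_3\\0&0&-1/h\end{bmatrix}$ with chosen $\alpha_1<0,\alpha_2<0,\alpha_3\in\mathbb R$, and $\underline A_c^TP_{m,0}+P_{m,0}\underline A_c=-Q_c$ with $P_{m,0}=P_{m,0}^T>0$, $Q_c=Q_c^T>0$. All gains $\Gamma$ are symmetric positive definite. *)

theory Defs
  imports "HOL-Analysis.Analysis"
begin

definition spd :: "real^'n^'n \<Rightarrow> bool" where
  "spd M \<longleftrightarrow> transpose M = M \<and> (\<forall>y. y \<noteq> 0 \<longrightarrow> y \<bullet> (M *v y) > 0)"

definition wnorm :: "real^'n^'n \<Rightarrow> real^'n \<Rightarrow> real" where
  "wnorm M y = sqrt (y \<bullet> (M *v y))"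

text \<open>The barrier function and its derivative are only meaningful for \<open>0 \<le> r < c\<close>.  The
  derivative is taken with respect to \<open>r\<^sup>2\<close>, see \<open>psi_deriv\<close> below.\<close>

definition psi :: "real \<Rightarrow> real \<Rightarrow> real" where
  "psi c r = r\<^sup>2 / (c - r)"

definition dpsi :: "real \<Rightarrow> real \<Rightarrow> real" where
  "dpsi c r = (2 * c - r) / (2 * (c - r)\<^sup>2)"

lemma psi_deriv:
  assumes "0 < r" "r < c"
  shows "((\<lambda>s. psi c (sqrt s)) has_real_derivative dpsi c r) (at (r\<^sup>2))"
proof -
  have s: "(sqrt has_real_derivative 1 / (2 * r)) (at (r\<^sup>2))"
    using DERIV_real_sqrt[of "r\<^sup>2"] assms by (simp add: field_simps)
  have p: "(psi c has_real_derivative (2 * r * (c - r) + r\<^sup>2) / (c - r)\<^sup>2) (at r)"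
    unfolding psi_def using assms
    by (auto intro!: derivative_eq_intros simp: power2_eq_square)
  have "(psi c has_real_derivative (2 * r * (c - r) + r\<^sup>2) / (c - r)\<^sup>2) (at (sqrt (r\<^sup>2)))"
    using p assms by simp
  from DERIV_chain2[OF this s]
  have "((\<lambda>s. psi c (sqrt s)) has_real_derivative
      (2 * r * (c - r) + r\<^sup>2) / (c - r)\<^sup>2 * (1 / (2 * r))) (at (r\<^sup>2))" .
  moreover have "(2 * r * (c - r) + r\<^sup>2) / (c - r)\<^sup>2 * (1 / (2 * r)) = dpsi c r"
  proof -
    have "2 * r * (c - r) + r\<^sup>2 = r * (2 * c - r)"
      by (simp add: algebra_simps power2_eq_square)
    then show ?thesis using assms by (simp add: dpsi_def)
  qed
  ultimately show ?thesis by simp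
qed

text \<open>\<open>solves x f\<close>: on \<open>[0, \<infinity>)\<close> the function \<open>x\<close> solves the differential equation with right-hand
  side \<open>f s\<close> evaluated along the trajectories.  The exogenous input is merely bounded, so solutions
  are taken in the integral sense.  Where the right-hand side is continuous in time, this is the
  same as classical differentiability; in general it is implied by it (\<open>classical_solves\<close>).\<close>

definition solves :: "(real \<Rightarrow> 'a::euclidean_space) \<Rightarrow> (real \<Rightarrow> 'a) \<Rightarrow> bool" where
  "solves x f \<longleftrightarrow> (\<forall>t\<ge>0. (f has_integral (x t - x 0)) {0..t})"

lemma classical_solves:
  assumes "\<And>t. t \<ge> 0 \<Longrightarrow> (x has_vector_derivative f t) (at t within {0..})"
  shows "solves x f"
  unfolding solves_def
proof (intro allI impI)
  fix t :: real assume "t \<ge> 0"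
  then show "(f has_integral (x t - x 0)) {0..t}"
    by (rule fundamental_theorem_of_calculus)
      (use assms in \<open>auto intro: has_vector_derivative_within_subset[where S = "{0..}"]\<close>)
qed

text \<open>A full vehicle state in \<open>real^4\<close> is \<open>(e, v, a, u\<^sub>b\<^sub>l)\<close>; a leader state in \<open>real^3\<close> is
  \<open>(v, a, u\<^sub>b\<^sub>l)\<close>.\<close>

definition A_m :: "real \<Rightarrow> real \<Rightarrow> real \<Rightarrow> real \<Rightarrow> real^4^4" where
  "A_m h k\<^sub>p k\<^sub>d tau =
    vector [vector [0, -1, -h, 0],
            vector [0, 0, 1, 0],
            vector [0, 0, - 1 / tau, 1 / tau],
            vector [k\<^sub>p / h, - k\<^sub>d / h, - k\<^sub>d, - 1 / h]]"

definition A_veh :: "real \<Rightarrow> real \<Rightarrow> real \<Rightarrow> real \<Rightarrow> real \<Rightarrow> real^4^4" where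
  "A_veh h k\<^sub>p k\<^sub>d tau Lam =
    vector [vector [0, -1, -h, 0],
            vector [0, 0, 1, 0],
            vector [0, 0, - 1 / tau, Lam / tau],
            vector [k\<^sub>p / h, - k\<^sub>d / h, - k\<^sub>d, - 1 / h]]"

definition B_w :: "real \<Rightarrow> real \<Rightarrow> real^2^4" where
  "B_w h k\<^sub>d =
    vector [vector [1, 0],
            vector [0, 0],
            vector [0, 0],
            vector [k\<^sub>d / h, 1 / h]]"

definition B_u :: "real^4" where
  "B_u = vector [0, 0, 1, 0]"

definition A_m0 :: "real \<Rightarrow> real \<Rightarrow> real^3^3" where
  "A_m0 h tau =
    vector [vector [0, 1, 0],
            vector [0, - 1 / tau, 1 / tau],
            vector [0, 0, - 1 / h]]"

definition A_lead :: "real \<Rightarrow> real \<Rightarrow> real \<Rightarrow> real^3^3" where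
  "A_lead h tau Lam =
    vector [vector [0, 1, 0],
            vector [0, - 1 / tau, Lam / tau],
            vector [0, 0, - 1 / h]]"

definition A_c :: "real \<Rightarrow> real \<Rightarrow> real \<Rightarrow> real \<Rightarrow> real^3^3" where
  "A_c h \<alpha>\<^sub>1 \<alpha>\<^sub>2 \<alpha>\<^sub>3 =
    vector [vector [0, 1, 0],
            vector [\<alpha>\<^sub>1, \<alpha>\<^sub>2, \<alpha>\<^sub>3],
            vector [0, 0, - 1 / h]]"

definition B_u0 :: "real^3" where
  "B_u0 = vector [0, 1, 0]"

definition B_r0 :: "real \<Rightarrow> real^3" where
  "B_r0 h = vector [0, 0, 1 / h]"

text \<open>The signal \<open>w = (v, u\<^sub>b\<^sub>l)\<close> passed to the following vehicle.\<close>

definition wsig :: "real^4 \<Rightarrow> real^2" where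
  "wsig x = vector [x $ 2, x $ 4]"

definition lead_full :: "real^3 \<Rightarrow> real^4" where
  "lead_full y = vector [0, y $ 1, y $ 2, y $ 3]"

text \<open>The Euclidean norm of the stacked vector \<open>(z\<^sub>0, \<dots>, z\<^sub>N)\<close> with blocks in \<open>real^4\<close>.\<close>

definition stack_norm :: "nat \<Rightarrow> (nat \<Rightarrow> real^4) \<Rightarrow> real" where
  "stack_norm N z = L2_set (\<lambda>j. norm (z j)) {..N}"

end

theory Submission
  imports Defs
begin

text \<open>
  The tracking error \<open>e\<close> of each vehicle satisfies \<open>e' = A e + \<theta> (\<kappa> \<bullet> \<phi>) b\<close>, with \<open>\<kappa>\<close> the gain error
  and \<open>\<phi>\<close> the regressor; the exogenous signals cancel because actual and reference vehicle receive
  the same ones.  Along solutions \<open>V = \<psi>(\<parallel>e\<parallel>) + \<theta> \<kappa> \<bullet> \<Gamma>\<^sup>-\<^sup>1 \<kappa>\<close> decreases at the rate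
  \<open>\<psi>'(\<parallel>e\<parallel>) e \<bullet> Q e\<close>.  Since \<open>\<psi>\<close> blows up at \<open>c\<close>, the bound \<open>\<parallel>e\<parallel> < c\<close> is never violated, and
  \<open>\<kappa>\<close> stays bounded.  Once \<open>\<phi>\<close> is known to be bounded, \<open>e\<close> is Lipschitz, and a Barbalat argument
  gives \<open>e \<rightarrow> 0\<close>.  For vehicle \<open>j\<close> the difference of virtual and reference state solves a stable linear
  system with matrix \<open>A\<^sub>m\<close> driven by the virtual minus actual state of vehicle \<open>j - 1\<close>, so
  convergence, and with it boundedness of the regressor, propagates along the string by induction.
\<close>

subsection \<open>Positive definite maps\<close>

text \<open>Phrased for linear maps rather than matrices, so that a block-diagonal gain on a product
  such as \<open>real^3 \<times> real^3\<close> is covered as well.\<close>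

definition pos_def_map :: "('a::euclidean_space \<Rightarrow> 'a) \<Rightarrow> bool" where
  "pos_def_map W \<longleftrightarrow> linear W \<and> (\<forall>u v. W u \<bullet> v = u \<bullet> W v) \<and> (\<forall>u. u \<noteq> 0 \<longrightarrow> u \<bullet> W u > 0)"

lemma pos_def_map_linear: "pos_def_map W \<Longrightarrow> linear W"
  and pos_def_map_sym: "pos_def_map W \<Longrightarrow> W u \<bullet> v = u \<bullet> W v"
  and pos_def_map_pos: "pos_def_map W \<Longrightarrow> u \<noteq> 0 \<Longrightarrow> u \<bullet> W u > 0"
  by (auto simp: pos_def_map_def)

lemma pos_def_map_nonneg: "pos_def_map W \<Longrightarrow> u \<bullet> W u \<ge> 0"
  using pos_def_map_pos[of W u] by (cases "u = 0") auto

lemma pos_def_map_bounded_linear: "pos_def_map W \<Longrightarrow> bounded_linear W"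
  by (simp add: pos_def_map_linear linear_conv_bounded_linear[symmetric])

text \<open>The form is continuous, so it attains a positive minimum on the compact unit sphere;
  homogeneity of degree two carries this bound to all vectors.\<close>

lemma pos_def_map_bounded_below:
  assumes W: "pos_def_map W"
  obtains m where "m > 0" "\<And>u. m * (norm u)\<^sup>2 \<le> u \<bullet> W u"
proof -
  have lin: "linear W" and bl: "bounded_linear W"
    using W by (auto intro: pos_def_map_linear pos_def_map_bounded_linear)
  obtain b :: 'a where b: "b \<in> Basis" using nonempty_Basis by blast
  have ne: "sphere (0::'a) 1 \<noteq> {}" using b norm_Basis by auto
  have "continuous_on (sphere 0 1) (\<lambda>u. u \<bullet> W u)"
    by (intro continuous_intros bounded_linear.continuous_on[OF bl])
  from continuous_attains_inf[OF compact_sphere ne this]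
  obtain u0 where u0: "u0 \<in> sphere 0 1" "\<And>u. u \<in> sphere 0 1 \<Longrightarrow> u0 \<bullet> W u0 \<le> u \<bullet> W u"
    by blast
  have "u0 \<noteq> 0" using u0(1) by auto
  then have pos: "u0 \<bullet> W u0 > 0" by (rule pos_def_map_pos[OF W])
  have "(u0 \<bullet> W u0) * (norm u)\<^sup>2 \<le> u \<bullet> W u" for u
  proof (cases "u = 0")
    case False
    define s where "s = u /\<^sub>R norm u"
    have us: "u = norm u *\<^sub>R s" using False by (simp add: s_def)
    have "s \<in> sphere 0 1" using False by (simp add: s_def)
    then have "(norm u)\<^sup>2 * (u0 \<bullet> W u0) \<le> (norm u)\<^sup>2 * (s \<bullet> W s)"
      using u0(2) by (simp add: mult_left_mono)
    also have "\<dots> = (norm u *\<^sub>R s) \<bullet> W (norm u *\<^sub>R s)"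
      by (simp add: linear_scale[OF lin] power2_eq_square)
    finally show ?thesis using us by (simp add: mult.commute)
  qed simp
  with pos that show thesis by blast
qed

lemma pos_def_map_bounded_above:
  assumes W: "pos_def_map W"
  obtains M where "M > 0" "\<And>u. u \<bullet> W u \<le> M * (norm u)\<^sup>2"
proof -
  obtain M where M: "M > 0" "\<And>u. norm (W u) \<le> norm u * M"
    using bounded_linear.pos_bounded[OF pos_def_map_bounded_linear[OF W]] by blast
  have "u \<bullet> W u \<le> M * (norm u)\<^sup>2" for u
  proof -
    have "u \<bullet> W u \<le> norm u * norm (W u)" by (rule norm_cauchy_schwarz)
    also have "\<dots> \<le> norm u * (norm u * M)" using M(2) by (simp add: mult_left_mono)
    finally show ?thesis by (simp add: power2_eq_square mult_ac)
  qed
  with M(1) that show thesis by blast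
qed

lemma pos_def_map_inj:
  assumes "pos_def_map G"
  shows "inj G"
  using pos_def_map_pos[OF assms]
  by (force simp: linear_injective_0[OF pos_def_map_linear[OF assms]])

text \<open>Symmetry and positivity come from evaluating the form of \<open>G\<close> at
  \<open>inv G u\<close>. The inverse gain weighs the gain error in the Lyapunov function.\<close>

lemma pos_def_map_inv:
  assumes G: "pos_def_map G"
  shows "pos_def_map (inv G)"
proof -
  have lin: "linear G" using G by (rule pos_def_map_linear)
  have inj: "inj G" using G by (rule pos_def_map_inj)
  have GW: "G (inv G u) = u" for u
    using linear_injective_imp_surjective[OF lin inj refl] by (rule surj_f_inv_f)
  have "linear (inv G)"
    by (rule linearI; rule injD[OF inj]) (simp_all add: GW linear_add[OF lin] linear_scale[OF lin])
  moreover have "inv G u \<bullet> v = u \<bullet> inv G v" for u v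
    using pos_def_map_sym[OF G, of "inv G u" "inv G v"] by (simp add: GW)
  moreover have "u \<bullet> inv G u > 0" if "u \<noteq> 0" for u
  proof -
    have "inv G u \<noteq> 0" using that GW[of u] linear_0[OF lin] by metis
    from pos_def_map_pos[OF G this] show ?thesis by (simp add: GW inner_commute)
  qed
  ultimately show ?thesis by (auto simp: pos_def_map_def)
qed

lemma pos_def_map_prod:
  assumes "pos_def_map F" "pos_def_map G"
  shows "pos_def_map (\<lambda>(u, v). (F u, G v))"
proof -
  have "linear (\<lambda>p. (F (fst p), G (snd p)))"
    using assms
    by (intro linearI)
      (auto simp: linear_add[OF pos_def_map_linear] linear_scale[OF pos_def_map_linear])
  moreover have "u \<bullet> F u + v \<bullet> G v > 0" if "(u, v) \<noteq> 0" for u v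
    using that pos_def_map_pos[OF assms(1), of u] pos_def_map_pos[OF assms(2), of v]
      pos_def_map_nonneg[OF assms(1), of u] pos_def_map_nonneg[OF assms(2), of v]
    by (auto simp: zero_prod_def intro: add_pos_nonneg add_nonneg_pos)
  ultimately show ?thesis
    using assms by (auto simp: pos_def_map_def case_prod_beta')
qed

section \<open>Matrices as linear maps and the Lyapunov equation\<close>

lemma matrix_vector_mult_continuous_on [continuous_intros]:
  fixes M :: "real^'n^'m"
  shows "continuous_on S f \<Longrightarrow> continuous_on S (\<lambda>t. M *v f t)"
  by (rule bounded_linear.continuous_on[OF matrix_vector_mul_bounded_linear])

lemma matrix_vector_inner_transpose:
  fixes M :: "real^'n^'m"
  shows "(M *v u) \<bullet> v = u \<bullet> (transpose M *v v)"
  by (metis dot_lmul_matrix inner_commute transpose_matrix_vector)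

lemma spd_pos_def_map:
  assumes "spd M"
  shows "pos_def_map ((*v) M)"
proof -
  have "(M *v u) \<bullet> v = u \<bullet> (M *v v)" for u v
    using matrix_vector_inner_transpose[of M u v] assms unfolding spd_def by metis
  then show ?thesis using assms by (auto simp: spd_def pos_def_map_def)
qed

text \<open>The left-hand side is the derivative of \<open>e \<bullet> (P *v e)\<close> along
  \<open>e' = A *v e\<close>. Both summands of the matrix equation contribute the same number
  because \<open>P\<close> is symmetric.\<close>

lemma lyapunov_inner:
  fixes A P Q :: "real^'n^'n"
  assumes "transpose A ** P + P ** A = - Q" and "spd P"
  shows "2 * ((P *v e) \<bullet> (A *v e)) = - (e \<bullet> (Q *v e))"
proof -
  have "Q + (transpose A ** P + P ** A) = 0" using assms(1) by simp
  then have "(Q + (transpose A ** P + P ** A)) *v e = 0" by (metis matrix_vector_mult_0)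
  then have "Q *v e + (transpose A *v (P *v e) + P *v (A *v e)) = 0"
    unfolding matrix_vector_mult_add_rdistrib matrix_vector_mul_assoc .
  then have "e \<bullet> (Q *v e) + (e \<bullet> (transpose A *v (P *v e)) + e \<bullet> (P *v (A *v e))) = 0"
    by (metis inner_add_right inner_zero_right)
  moreover have "e \<bullet> (transpose A *v (P *v e)) = (P *v e) \<bullet> (A *v e)"
    by (metis matrix_vector_inner_transpose inner_commute)
  moreover have "e \<bullet> (P *v (A *v e)) = (P *v e) \<bullet> (A *v e)"
    using pos_def_map_sym[OF spd_pos_def_map[OF assms(2)]] by metis
  ultimately show ?thesis by linarith
qed

lemma pos_def_map_has_derivative:
  assumes W: "pos_def_map W" and u: "(u has_vector_derivative u') (at t within S)"
  shows "((\<lambda>t. u t \<bullet> W (u t)) has_real_derivative 2 * (W (u t) \<bullet> u')) (at t within S)"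
proof -
  have "((\<lambda>t. W (u t)) has_vector_derivative W u') (at t within S)"
    by (rule bounded_linear.has_vector_derivative[OF pos_def_map_bounded_linear[OF W] u])
  from bounded_bilinear.has_vector_derivative[OF bounded_bilinear_inner u this]
  have "((\<lambda>t. u t \<bullet> W (u t)) has_vector_derivative u t \<bullet> W u' + u' \<bullet> W (u t)) (at t within S)" .
  moreover have "u t \<bullet> W u' + u' \<bullet> W (u t) = 2 * (W (u t) \<bullet> u')"
    using pos_def_map_sym[OF W, of "u t" u'] by (simp add: inner_commute)
  ultimately show ?thesis by (simp add: has_real_derivative_iff_has_vector_derivative)
qed

subsection \<open>Integral solutions\<close>

lemma solves_integral: "solves x f \<Longrightarrow> t \<ge> 0 \<Longrightarrow> x t = x 0 + integral {0..t} f"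
  unfolding solves_def by (metis add.commute diff_add_cancel integral_unique)

lemma solves_continuous_on_Icc:
  assumes "solves x f"
  shows "continuous_on {0..T} x"
proof (cases "T \<ge> 0")
  case True
  then have "f integrable_on {0..T}" using assms by (auto simp: solves_def)
  then have "continuous_on {0..T} (\<lambda>t. x 0 + integral {0..t} f)"
    by (intro continuous_intros indefinite_integral_continuous_1)
  then show ?thesis
    by (rule continuous_on_eq) (metis solves_integral[OF assms] atLeastAtMost_iff)
qed simp

lemma continuous_on_atLeast_iff_Icc:
  fixes f :: "real \<Rightarrow> 'a::topological_space"
  shows "continuous_on {a..} f \<longleftrightarrow> (\<forall>b. continuous_on {a..b} f)"
proof (intro iffI allI)
  assume *: "\<forall>b. continuous_on {a..b} f"
  show "continuous_on {a..} f"
    unfolding continuous_on_eq_continuous_within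
  proof
    fix t assume "t \<in> {a..}"
    then have "continuous (at t within {a..t + 1}) f"
      using * by (simp add: continuous_on_eq_continuous_within)
    moreover have "at t within {a..t + 1} = at t within {a..}"
      by (rule at_within_nhd[of _ "{..<t + 1}"]) auto
    ultimately show "continuous (at t within {a..}) f" by simp
  qed
qed (auto intro: continuous_on_subset)

lemma solves_continuous_on: "solves x f \<Longrightarrow> continuous_on {0..} x"
  by (simp add: continuous_on_atLeast_iff_Icc solves_continuous_on_Icc)

text \<open>Fundamental theorem of calculus: with a continuous right-hand side an integral solution
  is a classical one, one-sided at the end points.\<close>

lemma solves_has_vector_derivative:
  assumes x: "solves x f" and f: "continuous_on {0..T} f" and t: "t \<in> {0..T}"
  shows "(x has_vector_derivative f t) (at t within {0..T})"
proof -
  have "((\<lambda>t. x 0 + integral {0..t} f) has_vector_derivative 0 + f t) (at t within {0..T})"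
    by (intro derivative_intros integral_has_vector_derivative f t)
  then have "((\<lambda>t. x 0 + integral {0..t} f) has_vector_derivative f t) (at t within {0..T})"
    by simp
  then show ?thesis
    by (rule has_vector_derivative_transform[rotated 2])
      (use t in \<open>auto intro: solves_integral[OF x]\<close>)
qed

lemma solves_cong:
  assumes "solves x f" "\<And>t. t \<ge> 0 \<Longrightarrow> x t = x' t" "\<And>t. t \<ge> 0 \<Longrightarrow> f t = f' t"
  shows "solves x' f'"
  unfolding solves_def
proof (intro allI impI)
  fix t :: real assume t: "t \<ge> 0"
  then have "(f has_integral x' t - x' 0) {0..t}"
    using assms(1,2) by (auto simp: solves_def)
  then show "(f' has_integral x' t - x' 0) {0..t}"
    by (rule has_integral_eq[rotated]) (use assms(3) in auto)
qed

text \<open>For the leader this cancels the possibly discontinuous input before anything is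
  differentiated: the error equation has a continuous right-hand side.\<close>

lemma solves_diff:
  assumes "solves x f" "solves y g"
  shows "solves (\<lambda>t. x t - y t) (\<lambda>t. f t - g t)"
  unfolding solves_def
proof (intro allI impI)
  fix t :: real assume "t \<ge> 0"
  then have "((\<lambda>t. f t - g t) has_integral (x t - x 0) - (y t - y 0)) {0..t}"
    using assms unfolding solves_def by (intro has_integral_diff) auto
  then show "((\<lambda>t. f t - g t) has_integral (x t - y t) - (x 0 - y 0)) {0..t}"
    by (simp add: algebra_simps)
qed

lemma solves_Pair:
  assumes "solves x f" "solves y g"
  shows "solves (\<lambda>t. (x t, y t)) (\<lambda>t. (f t, g t))"
  unfolding solves_def
proof (intro allI impI)
  fix t :: real assume t: "t \<ge> 0"
  have f: "(f has_integral x t - x 0) {0..t}" and g: "(g has_integral y t - y 0) {0..t}"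
    using assms t by (auto simp: solves_def)
  have "bounded_linear (\<lambda>u. (u, 0))" "bounded_linear (\<lambda>u. (0, u))"
    by (auto intro!: bounded_linear_Pair bounded_linear_ident bounded_linear_zero)
  from has_integral_add[OF has_integral_linear[OF f this(1)] has_integral_linear[OF g this(2)]]
  show "((\<lambda>t. (f t, g t)) has_integral (x t, y t) - (x 0, y 0)) {0..t}"
    by (simp add: o_def)
qed

lemma solves_has_vector_derivative_at:
  assumes x: "solves x f" and f: "continuous_on {0..} f" and t: "t > 0"
  shows "(x has_vector_derivative f t) (at t)"
proof -
  have "continuous_on {0..t + 1} f" using f by (simp add: continuous_on_atLeast_iff_Icc)
  from solves_has_vector_derivative[OF x this, of t] show ?thesis
    using t by (simp add: at_within_Icc_at)
qed

lemma DERIV_nonpos_within_Icc_imp_le: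
  fixes V :: "real \<Rightarrow> real"
  assumes "a \<le> b" and V: "\<And>t. t \<in> {a..b} \<Longrightarrow> (V has_real_derivative V' t) (at t within {a..b})"
    and V': "\<And>t. t \<in> {a..b} \<Longrightarrow> V' t \<le> 0"
  shows "V b \<le> V a"
proof (rule DERIV_nonpos_imp_decreasing_open[OF \<open>a \<le> b\<close>])
  show "continuous_on {a..b} V" using V by (rule DERIV_continuous_on)
  fix t assume "a < t" "t < b"
  then show "\<exists>y. DERIV V t :> y \<and> y \<le> 0"
    using V[of t] V'[of t] by (auto simp: at_within_Icc_at)
qed

subsection \<open>Convergence criteria\<close>

text \<open>\<open>V\<close> is nonincreasing and bounded below, so it eventually has only a small
  amount left to lose. A late time with \<open>norm (e t) \<ge> \<epsilon>\<close> would, by the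
  Lipschitz bound, be followed by an interval of fixed length on which \<open>e\<close> stays large,
  and \<open>V\<close> would lose more than that.\<close>

lemma barbalat_lyapunov:
  fixes e :: "real \<Rightarrow> 'a::real_normed_vector"
  assumes V: "\<And>t. t > 0 \<Longrightarrow> (V has_real_derivative V' t) (at t)"
    and V': "\<And>t. t > 0 \<Longrightarrow> V' t \<le> - \<kappa> * (norm (e t))\<^sup>2"
    and V0: "\<And>t. t > 0 \<Longrightarrow> V t \<ge> 0" and "\<kappa> > 0" and e: "L-lipschitz_on {0<..} e"
  shows "(e \<longlongrightarrow> 0) at_top"
proof (rule tendstoI)
  fix \<epsilon> :: real assume "\<epsilon> > 0"
  \<comment> \<open>The added 1 keeps the divisor in \<open>\<delta>\<close> positive even if
    \<open>L = 0\<close>. With this choice \<open>e\<close> moves by at most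
    \<open>\<epsilon> / 2\<close> during a time \<open>\<delta>\<close>.\<close>
  define M where "M = L + 1"
  have M: "M > 0" using lipschitz_on_nonneg[OF e] by (simp add: M_def)
  define \<delta> where "\<delta> = \<epsilon> / (2 * M)"
  have \<delta>: "\<delta> > 0" using M \<open>\<epsilon> > 0\<close> by (simp add: \<delta>_def)
  \<comment> \<open>While \<open>norm (e s) \<ge> \<epsilon> / 2\<close>, \<open>V\<close> decreases
    at least at rate \<open>r\<close>, hence by at least \<open>r * \<delta>\<close> over an
    interval of length \<open>\<delta>\<close>.\<close>
  define r where "r = \<kappa> * (\<epsilon> / 2)\<^sup>2"
  have r: "r > 0" using \<open>\<kappa> > 0\<close> \<open>\<epsilon> > 0\<close> by (simp add: r_def)
  define l where "l = Inf (V ` {1..})"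
  have bdd: "bdd_below (V ` {1..})" by (rule bdd_belowI[of _ 0]) (use V0 in force)
  have "Inf (V ` {1..}) < l + r * \<delta>" using r \<delta> by (simp add: l_def)
  then obtain T where T: "T \<ge> 1" "V T < l + r * \<delta>"
    by (subst (asm) cInf_less_iff) (auto intro: bdd)
  have "norm (e t) < \<epsilon>" if t: "t \<ge> T" for t
  proof (rule ccontr)
    assume "\<not> norm (e t) < \<epsilon>"
    then have large: "norm (e t) \<ge> \<epsilon>" by simp
    have half: "norm (e s) \<ge> \<epsilon> / 2" if "s \<in> {t..t + \<delta>}" for s
    proof -
      have "norm (e t) - norm (e s) \<le> dist (e s) (e t)"
        by (metis dist_commute dist_norm norm_triangle_ineq2)
      also have "\<dots> \<le> L * dist s t"
        by (rule lipschitz_onD[OF e]) (use that t T(1) in auto)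
      also have "\<dots> \<le> M * \<delta>"
        using that lipschitz_on_nonneg[OF e] by (intro mult_mono) (auto simp: M_def dist_real_def)
      also have "\<dots> = \<epsilon> / 2" using M by (simp add: \<delta>_def)
      finally show ?thesis using large by simp
    qed
    have "V T \<ge> V t"
    proof (rule DERIV_nonpos_imp_nonincreasing[OF t])
      fix s assume "T \<le> s" "s \<le> t"
      then have "s > 0" using T by simp
      moreover have "- \<kappa> * (norm (e s))\<^sup>2 \<le> 0" using \<open>\<kappa> > 0\<close> by simp
      ultimately show "\<exists>y. DERIV V s :> y \<and> y \<le> 0" using V[of s] V'[of s] by force
    qed
    moreover have "V t + r * t \<ge> V (t + \<delta>) + r * (t + \<delta>)"
    proof (rule DERIV_nonpos_imp_nonincreasing[where f = "\<lambda>s. V s + r * s"])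
      show "t \<le> t + \<delta>" using \<delta> by simp
      fix s assume s: "t \<le> s" "s \<le> t + \<delta>"
      then have "s > 0" using T t by simp
      have "(\<epsilon> / 2)\<^sup>2 \<le> (norm (e s))\<^sup>2"
        using half[of s] s \<open>\<epsilon> > 0\<close> by (intro power_mono) auto
      then have "r \<le> \<kappa> * (norm (e s))\<^sup>2" using \<open>\<kappa> > 0\<close> by (simp add: r_def)
      then have "V' s + r \<le> 0" using V'[OF \<open>s > 0\<close>] by simp
      moreover have "((\<lambda>s. V s + r * s) has_real_derivative V' s + r) (at s)"
        by (auto intro!: derivative_eq_intros V[OF \<open>s > 0\<close>])
      ultimately show "\<exists>y. DERIV (\<lambda>s. V s + r * s) s :> y \<and> y \<le> 0" by blast
    qed
    moreover have "l \<le> V (t + \<delta>)"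
      unfolding l_def by (rule cInf_lower[OF _ bdd]) (use t T(1) \<delta> in auto)
    ultimately show False using T(2) by (simp add: algebra_simps)
  qed
  then show "\<forall>\<^sub>F t in at_top. dist (e t) 0 < \<epsilon>"
    by (auto simp: eventually_at_top_linorder intro!: exI[of _ T])
qed

text \<open>Once \<open>p\<close> is below \<open>\<mu> * (\<epsilon> / 2)\<close>, the integrating
  factor \<open>exp (\<mu> * t)\<close> makes
  \<open>exp (\<mu> * t) * (U t - \<epsilon> / 2)\<close> nonincreasing. So \<open>U t\<close>
  exceeds \<open>\<epsilon> / 2\<close> by at most an exponentially decaying term.\<close>

lemma differential_inequality_tendsto_0:
  fixes U :: "real \<Rightarrow> real"
  assumes U: "\<And>t. t > 0 \<Longrightarrow> (U has_real_derivative U' t) (at t)"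
    and U': "\<And>t. t > 0 \<Longrightarrow> U' t \<le> - \<mu> * U t + p t"
    and U0: "\<And>t. t > 0 \<Longrightarrow> U t \<ge> 0" and "\<mu> > 0" and p: "(p \<longlongrightarrow> 0) at_top"
  shows "(U \<longlongrightarrow> 0) at_top"
proof (rule tendstoI)
  fix \<epsilon> :: real assume "\<epsilon> > 0"
  then have "\<forall>\<^sub>F t in at_top. p t < \<mu> * (\<epsilon> / 2)"
    using \<open>\<mu> > 0\<close> by (intro order_tendstoD(2)[OF p]) simp
  then obtain T0 where T0: "\<And>t. t \<ge> T0 \<Longrightarrow> p t < \<mu> * (\<epsilon> / 2)"
    by (auto simp: eventually_at_top_linorder)
  define T where "T = max T0 1"
  define F where "F t = exp (\<mu> * t) * (U t - \<epsilon> / 2)" for t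
  have F: "F t \<le> F T" if "t \<ge> T" for t
  proof (rule DERIV_nonpos_imp_nonincreasing[OF that])
    fix s assume "T \<le> s"
    then have s: "s > 0" "s \<ge> T0" by (auto simp: T_def)
    have "(F has_real_derivative exp (\<mu> * s) * (\<mu> * (U s - \<epsilon> / 2) + U' s)) (at s)"
      unfolding F_def
      by (auto intro!: derivative_eq_intros U[OF s(1)] simp: algebra_simps)
    moreover have "\<mu> * (U s - \<epsilon> / 2) + U' s \<le> 0"
      using U'[OF s(1)] T0[OF s(2)] by (simp add: algebra_simps)
    ultimately show "\<exists>y. DERIV F s :> y \<and> y \<le> 0"
      by (metis exp_ge_zero mult_nonneg_nonpos)
  qed
  have "((\<lambda>t. exp (- \<mu> * t) * F T) \<longlongrightarrow> 0 * F T) at_top"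
  proof (intro tendsto_intros filterlim_compose[OF exp_at_bot])
    show "filterlim (\<lambda>t. - \<mu> * t) at_bot at_top"
      using \<open>\<mu> > 0\<close>
      by (intro filterlim_tendsto_neg_mult_at_bot[OF tendsto_const]) (auto simp: filterlim_ident)
  qed
  then have "\<forall>\<^sub>F t in at_top. exp (- \<mu> * t) * F T < \<epsilon> / 2"
    using \<open>\<epsilon> > 0\<close> by (intro order_tendstoD(2)) auto
  moreover have "\<forall>\<^sub>F t in at_top. t \<ge> T" by (rule eventually_ge_at_top)
  ultimately show "\<forall>\<^sub>F t in at_top. dist (U t) 0 < \<epsilon>"
  proof eventually_elim
    case (elim t)
    have "U t - \<epsilon> / 2 = exp (- \<mu> * t) * F t" by (simp add: F_def exp_minus)
    also have "\<dots> \<le> exp (- \<mu> * t) * F T" using F[OF elim(2)] by simp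
    finally have "U t < \<epsilon>" using elim(1) by simp
    moreover have "t > 0" using elim(2) by (simp add: T_def)
    ultimately show ?case using U0[of t] by simp
  qed
qed

text \<open>The quadratic form of \<open>P\<close> along \<open>z\<close> decays up to a
  perturbation of the order of the squared input, which reduces the claim to the scalar differential
  inequality.\<close>

lemma hurwitz_vanishing_input:
  fixes A P Q :: "real^'n^'n" and z g :: "real \<Rightarrow> real^'n"
  assumes P: "spd P" and Q: "spd Q" and lyap: "transpose A ** P + P ** A = - Q"
    and z: "solves z (\<lambda>t. A *v z t + g t)"
    and g: "continuous_on {0..} g" and g0: "(g \<longlongrightarrow> 0) at_top"
  shows "(z \<longlongrightarrow> 0) at_top"
proof -
  note pP = spd_pos_def_map[OF P] and pQ = spd_pos_def_map[OF Q]
  obtain mP where mP: "mP > 0" "\<And>u. mP * (norm u)\<^sup>2 \<le> u \<bullet> (P *v u)"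
    using pos_def_map_bounded_below[OF pP] by metis
  obtain mQ where mQ: "mQ > 0" "\<And>u. mQ * (norm u)\<^sup>2 \<le> u \<bullet> (Q *v u)"
    using pos_def_map_bounded_below[OF pQ] by metis
  obtain M where M: "M > 0" "\<And>u. u \<bullet> (P *v u) \<le> M * (norm u)\<^sup>2"
    using pos_def_map_bounded_above[OF pP] by metis
  obtain K where K: "K > 0" "\<And>u. norm (P *v u) \<le> norm u * K"
    using bounded_linear.pos_bounded[OF pos_def_map_bounded_linear[OF pP]] by blast
  define U where "U t = z t \<bullet> (P *v z t)" for t
  define U' where "U' t = 2 * ((P *v z t) \<bullet> (A *v z t + g t))" for t
  have zc: "continuous_on {0..} z" using z by (rule solves_continuous_on)
  have fc: "continuous_on {0..} (\<lambda>t. A *v z t + g t)"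
    by (intro continuous_intros zc g)
  have "(U \<longlongrightarrow> 0) at_top"
  proof (rule differential_inequality_tendsto_0)
    show "(U has_real_derivative U' t) (at t)" if "t > 0" for t
      unfolding U_def U'_def
      by (rule pos_def_map_has_derivative[OF pP solves_has_vector_derivative_at[OF z fc that]])
    show "U t \<ge> 0" for t unfolding U_def by (rule pos_def_map_nonneg[OF pP])
    show "mQ / (2 * M) > 0" using mQ M by simp
    have "((\<lambda>t. 2 * K\<^sup>2 / mQ * (norm (g t))\<^sup>2) \<longlongrightarrow> 2 * K\<^sup>2 / mQ * (norm (0 :: real^'n))\<^sup>2) at_top"
      by (intro tendsto_intros g0)
    then show "((\<lambda>t. 2 * K\<^sup>2 / mQ * (norm (g t))\<^sup>2) \<longlongrightarrow> 0) at_top" by simp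
    show "U' t \<le> - (mQ / (2 * M)) * U t + 2 * K\<^sup>2 / mQ * (norm (g t))\<^sup>2" for t
    proof -
      have "U' t = - (z t \<bullet> (Q *v z t)) + 2 * ((P *v z t) \<bullet> g t)"
        using lyapunov_inner[OF lyap P, of "z t"] by (simp add: U'_def inner_add_right)
      moreover have "(P *v z t) \<bullet> g t \<le> norm (z t) * K * norm (g t)"
        using norm_cauchy_schwarz[of "P *v z t" "g t"] K(2)[of "z t"]
        by (meson mult_right_mono norm_ge_zero order_trans)
      moreover have "2 * (norm (z t) * K * norm (g t))
          \<le> mQ / 2 * (norm (z t))\<^sup>2 + 2 * K\<^sup>2 / mQ * (norm (g t))\<^sup>2"
      proof -
        \<comment> \<open>Young's inequality by completing the square. The weights let the cross
          term use up only half of the dissipation given by \<open>mQ\<close>; the other half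
          dominates \<open>mQ / (2 * M) * U t\<close>.\<close>
        have "0 \<le> (mQ * norm (z t) - 2 * K * norm (g t))\<^sup>2 / (2 * mQ)" using mQ by simp
        also have "\<dots> = mQ / 2 * (norm (z t))\<^sup>2 + 2 * K\<^sup>2 / mQ * (norm (g t))\<^sup>2
            - 2 * (norm (z t) * K * norm (g t))"
          using mQ(1) by (simp add: power2_eq_square field_simps)
        finally show ?thesis by simp
      qed
      moreover have "mQ / (2 * M) * U t \<le> mQ / 2 * (norm (z t))\<^sup>2"
        using M(2)[of "z t"] M(1) mQ(1) by (simp add: U_def field_simps)
      ultimately show ?thesis using mQ(2)[of "z t"] by simp
    qed
  qed
  then have "((\<lambda>t. U t / mP) \<longlongrightarrow> 0) at_top" by (rule tendsto_divide_zero)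
  then have "((\<lambda>t. (norm (z t))\<^sup>2) \<longlongrightarrow> 0) at_top"
    by (rule tendsto_sandwich[OF _ _ tendsto_const, rotated 2])
      (use mP in \<open>auto simp: U_def field_simps\<close>)
  then have "((\<lambda>t. norm (z t)) \<longlongrightarrow> 0) at_top" by simp
  then show ?thesis by (rule tendsto_norm_zero_cancel)
qed

text \<open>At \<open>s = 0\<close> the square root is not differentiable, but \<open>\<psi>(\<surd>s) = s / (c - \<surd>s)\<close> is.\<close>

lemma psi_sqrt_has_real_derivative:
  assumes "0 \<le> s" "sqrt s < c"
  shows "((\<lambda>s. psi c (sqrt s)) has_real_derivative dpsi c (sqrt s)) (at s within {0..})"
proof (cases "s = 0")
  case True
  then have "c > 0" using assms by simp
  have "((\<lambda>s. 1 / (c - sqrt s)) \<longlongrightarrow> 1 / (c - sqrt 0)) (at 0 within {0..})"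
    using \<open>c > 0\<close> by (intro tendsto_intros) auto
  moreover have "\<forall>\<^sub>F s in at 0 within {0..}. 1 / (c - sqrt s) = (psi c (sqrt s) - psi c (sqrt 0)) / (s - 0)"
    by (auto simp: eventually_at_filter psi_def)
  ultimately have "((\<lambda>s. psi c (sqrt s)) has_real_derivative 1 / c) (at 0 within {0..})"
    by (auto simp: has_field_derivative_iff elim: Lim_transform_eventually)
  then show ?thesis using True \<open>c > 0\<close> by (simp add: dpsi_def power2_eq_square)
next
  case False
  then show ?thesis
    using psi_deriv[of "sqrt s" c] assms by (auto intro: has_field_derivative_at_within)
qed

subsection \<open>Adaptive tracking with a barrier function\<close>

lemma wnorm_power2: "spd P \<Longrightarrow> (wnorm P u)\<^sup>2 = u \<bullet> (P *v u)"
  and wnorm_nonneg: "spd P \<Longrightarrow> 0 \<le> wnorm P u"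
  using pos_def_map_nonneg[OF spd_pos_def_map] by (auto simp: wnorm_def)

text \<open>The numerator is at least \<open>c\<close> and the denominator at most
  \<open>2 * c\<^sup>2\<close>. This makes the dissipation uniform in the error.\<close>

lemma dpsi_lower_bound:
  assumes "0 \<le> r" "r < c"
  shows "1 / (2 * c) \<le> dpsi c r"
proof -
  have "c / (2 * c\<^sup>2) \<le> (2 * c - r) / (2 * (c - r)\<^sup>2)"
    using assms by (intro frac_le mult_left_mono power_mono) auto
  then show ?thesis using assms by (simp add: dpsi_def power2_eq_square)
qed

text \<open>Multiplying out the denominator gives a bound that is continuous up to
  \<open>r = c\<close>, where \<open>psi\<close> has its pole.\<close>

lemma psi_le_imp:
  assumes "r < c" "psi c r \<le> K"
  shows "r\<^sup>2 \<le> K * (c - r)"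
  using assms by (simp add: psi_def field_simps)

text \<open>The regressor \<open>\<phi>\<close> and the gain \<open>k\<close> live in an arbitrary Euclidean space, so that the two
  adaptive laws of the leader become one law in \<open>real^3 \<times> real^3\<close>.\<close>

locale barrier_tracking =
  fixes A P Q :: "real^'n^'n" and b :: "real^'n" and \<theta> c :: real
    and G :: "'b::euclidean_space \<Rightarrow> 'b"
    and e :: "real \<Rightarrow> real^'n" and k \<phi> :: "real \<Rightarrow> 'b" and k_star :: 'b
  assumes P: "spd P" and Q: "spd Q" and lyap: "transpose A ** P + P ** A = - Q"
    and \<theta>: "\<theta> > 0" and c: "c > 0" and G: "pos_def_map G"
    and e: "solves e (\<lambda>t. A *v e t + (\<theta> * ((k t - k_star) \<bullet> \<phi> t)) *\<^sub>R b)"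
    and k: "solves k (\<lambda>t. - (dpsi c (wnorm P (e t)) *\<^sub>R G ((e t \<bullet> (P *v b)) *\<^sub>R \<phi> t)))"
    and \<phi>: "continuous_on {0..} \<phi>"
    and init: "wnorm P (e 0) < c"
begin

text \<open>The weight \<open>\<theta>\<close> of the gain term matches the factor
  \<open>\<theta>\<close> in the error equation, so that the cross terms cancel although the
  adaptive law does not contain the unknown \<open>\<theta>\<close>.\<close>

definition V :: "real \<Rightarrow> real" where
  "V t = psi c (wnorm P (e t)) + \<theta> * ((k t - k_star) \<bullet> inv G (k t - k_star))"

lemma continuous_e: "continuous_on {0..} e"
  and continuous_k: "continuous_on {0..} k"
  using e k by (auto intro: solves_continuous_on)

lemma continuous_wnorm_e: "continuous_on {0..} (\<lambda>t. wnorm P (e t))"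
  unfolding wnorm_def by (intro continuous_intros continuous_e)

lemma continuous_rhs_e:
  "continuous_on {0..} (\<lambda>t. A *v e t + (\<theta> * ((k t - k_star) \<bullet> \<phi> t)) *\<^sub>R b)"
  by (intro continuous_intros continuous_e continuous_k \<phi>)

text \<open>The hypothesis \<open>safe\<close> stays away from the pole of \<open>dpsi\<close> at
  \<open>c\<close>, so the adaptive law has a continuous right-hand side on the interval and
  \<open>k\<close> is differentiable there. The law is designed so that its contribution cancels the
  gain-error term of the error equation.\<close>

lemma V_has_derivative:
  assumes safe: "\<And>t. t \<in> {0..T} \<Longrightarrow> wnorm P (e t) < c" and t: "t \<in> {0..T}"
  shows "(V has_real_derivative - (dpsi c (wnorm P (e t)) * (e t \<bullet> (Q *v e t))))
    (at t within {0..T})"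
proof -
  note [simp] = pos_def_map_linear[OF G, THEN linear_scale]
  let ?d = "\<lambda>t. dpsi c (wnorm P (e t))"
  let ?\<kappa> = "\<lambda>t. k t - k_star"
  let ?e' = "A *v e t + (\<theta> * (?\<kappa> t \<bullet> \<phi> t)) *\<^sub>R b"
  let ?k' = "- (?d t *\<^sub>R G ((e t \<bullet> (P *v b)) *\<^sub>R \<phi> t))"
  have e_der: "(e has_vector_derivative ?e') (at t within {0..T})"
    by (rule solves_has_vector_derivative[OF e _ t])
      (rule continuous_on_subset[OF continuous_rhs_e], auto)
  have sub: "{0..T} \<subseteq> {0..}" by auto
  have cont_e: "continuous_on {0..T} e" and cont_\<phi>: "continuous_on {0..T} \<phi>"
    and cont_w: "continuous_on {0..T} (\<lambda>t. wnorm P (e t))"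
    by (auto intro: continuous_on_subset[OF _ sub] continuous_e \<phi> continuous_wnorm_e)
  have "continuous_on {0..T} (\<lambda>t. - (?d t *\<^sub>R G ((e t \<bullet> (P *v b)) *\<^sub>R \<phi> t)))"
    unfolding dpsi_def
    by (intro continuous_intros cont_e cont_\<phi> cont_w
        bounded_linear.continuous_on[OF pos_def_map_bounded_linear[OF G]])
      (use safe in force)
  from solves_has_vector_derivative[OF k this t]
  have "(?\<kappa> has_vector_derivative ?k' - 0) (at t within {0..T})"
    by (intro derivative_intros)
  then have "((\<lambda>t. ?\<kappa> t \<bullet> inv G (?\<kappa> t)) has_real_derivative 2 * (inv G (?\<kappa> t) \<bullet> (?k' - 0)))
      (at t within {0..T})"
    by (rule pos_def_map_has_derivative[OF pos_def_map_inv[OF G]])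
  moreover have "inv G (?\<kappa> t) \<bullet> G u = ?\<kappa> t \<bullet> u" for u
    using pos_def_map_sym[OF pos_def_map_inv[OF G], of "?\<kappa> t" "G u"]
    by (simp add: inv_f_f[OF pos_def_map_inj[OF G]])
  ultimately have k_der: "((\<lambda>t. ?\<kappa> t \<bullet> inv G (?\<kappa> t)) has_real_derivative
      - 2 * (?d t * (e t \<bullet> (P *v b)) * (?\<kappa> t \<bullet> \<phi> t))) (at t within {0..T})"
    by (simp add: mult_ac)
  have sq_der: "((\<lambda>t. e t \<bullet> (P *v e t)) has_real_derivative 2 * ((P *v e t) \<bullet> ?e')) (at t within {0..T})"
    by (rule pos_def_map_has_derivative[OF spd_pos_def_map[OF P] e_der])
  \<comment> \<open>The derivative of \<open>psi c (sqrt s)\<close> is available only within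
    \<open>{0..}\<close>, being one-sided at 0; the chain rule is therefore applied within the image
    of the quadratic form.\<close>
  have img: "(\<lambda>t. e t \<bullet> (P *v e t)) ` {0..T} \<subseteq> {0..}"
    using pos_def_map_nonneg[OF spd_pos_def_map[OF P]] by auto
  have "((\<lambda>s. psi c (sqrt s)) has_real_derivative ?d t)
      (at (e t \<bullet> (P *v e t)) within (\<lambda>t. e t \<bullet> (P *v e t)) ` {0..T})"
    using psi_sqrt_has_real_derivative[of "e t \<bullet> (P *v e t)" c] safe[OF t]
      pos_def_map_nonneg[OF spd_pos_def_map[OF P], of "e t"]
    by (auto simp: wnorm_def intro: has_field_derivative_subset[OF _ img])
  from DERIV_image_chain[OF this sq_der]
  have psi_der: "((\<lambda>t. psi c (wnorm P (e t))) has_real_derivative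
      ?d t * (2 * ((P *v e t) \<bullet> ?e'))) (at t within {0..T})"
    by (simp add: o_def wnorm_def)
  have "e t \<bullet> (P *v b) = (P *v e t) \<bullet> b"
    using pos_def_map_sym[OF spd_pos_def_map[OF P], of "e t" b] by simp
  then have "2 * ((P *v e t) \<bullet> ?e')
      = - (e t \<bullet> (Q *v e t)) + 2 * \<theta> * (?\<kappa> t \<bullet> \<phi> t) * (e t \<bullet> (P *v b))"
    using lyapunov_inner[OF lyap P, of "e t"] by (simp add: inner_add_right algebra_simps)
  \<comment> \<open>The cancellation of the cross terms, isolated as an identity of real
    numbers.\<close>
  moreover have "d * (- q + 2 * \<theta> * \<kappa> * p) + \<theta> * (- 2 * (d * p * \<kappa>)) = - (d * q)" for d q \<kappa> p :: real
    by (simp add: algebra_simps)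
  ultimately have "?d t * (2 * ((P *v e t) \<bullet> ?e'))
        + \<theta> * (- 2 * (?d t * (e t \<bullet> (P *v b)) * (?\<kappa> t \<bullet> \<phi> t)))
      = - (?d t * (e t \<bullet> (Q *v e t)))"
    by (simp only:)
  with DERIV_add[OF psi_der DERIV_cmult[OF k_der, of \<theta>]] show ?thesis
    by (simp add: V_def[abs_def])
qed

lemma dissipation_nonneg:
  "wnorm P (e t) < c \<Longrightarrow> 0 \<le> dpsi c (wnorm P (e t)) * (e t \<bullet> (Q *v e t))"
  using dpsi_lower_bound[OF wnorm_nonneg[OF P, of "e t"], of c] c
    pos_def_map_nonneg[OF spd_pos_def_map[OF Q], of "e t"]
  by (intro mult_nonneg_nonneg) (auto intro: order_trans[rotated])

lemma V_le_init:
  assumes "\<And>t. t \<in> {0..T} \<Longrightarrow> wnorm P (e t) < c" "T \<ge> 0"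
  shows "V T \<le> V 0"
  using assms
  by (intro DERIV_nonpos_within_Icc_imp_le[OF _ V_has_derivative])
    (auto dest!: dissipation_nonneg)

lemma V_nonneg:
  assumes "wnorm P (e t) < c"
  shows "0 \<le> V t" "psi c (wnorm P (e t)) \<le> V t"
    "\<theta> * ((k t - k_star) \<bullet> inv G (k t - k_star)) \<le> V t"
proof -
  have "0 \<le> psi c (wnorm P (e t))" using assms by (simp add: psi_def)
  moreover have "0 \<le> \<theta> * ((k t - k_star) \<bullet> inv G (k t - k_star))"
    using \<theta> pos_def_map_nonneg[OF pos_def_map_inv[OF G]] by simp
  ultimately show "0 \<le> V t" "psi c (wnorm P (e t)) \<le> V t"
    "\<theta> * ((k t - k_star) \<bullet> inv G (k t - k_star)) \<le> V t" by (auto simp: V_def)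
qed

text \<open>First-hitting-time argument: before the barrier is reached, \<open>V\<close> is bounded
  by its initial value, which prevents the weighted norm from tending to \<open>c\<close>.\<close>

lemma barrier_invariant:
  assumes "t \<ge> 0"
  shows "wnorm P (e t) < c"
proof (rule ccontr)
  let ?r = "\<lambda>t. wnorm P (e t)"
  assume "\<not> ?r t < c"
  define S where "S = {0..} \<inter> ?r -` {c..}"
  have S: "S \<noteq> {}" "bdd_below S" "closed S"
    using assms \<open>\<not> ?r t < c\<close>
    by (auto simp: S_def intro!: bdd_belowI[of _ 0] continuous_closed_preimage continuous_wnorm_e)
  define s where "s = Inf S"
  have "s \<in> S" unfolding s_def by (rule closed_contains_Inf[OF S])
  then have s: "s \<ge> 0" "?r s \<ge> c" by (auto simp: S_def)
  have "s \<noteq> 0" using init s by auto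
  with s have "s > 0" by simp
  have before: "?r u < c" if "u \<in> {0..<s}" for u
    using that cInf_lower[OF _ S(2), of u] by (force simp: S_def s_def)
  \<comment> \<open>The multiplied-out bound passes to the limit \<open>s\<close> by continuity.
    There \<open>c - ?r s \<le> 0\<close>, so it would force
    \<open>(?r s)\<^sup>2 \<le> 0\<close>.\<close>
  have "(?r u)\<^sup>2 - V 0 * (c - ?r u) \<le> 0" if "u \<in> {0..<s}" for u
  proof -
    have "V u \<le> V 0" using that before by (intro V_le_init) auto
    then have "psi c (?r u) \<le> V 0" using V_nonneg(2)[OF before[OF that]] by simp
    then show ?thesis using psi_le_imp before[OF that] by force
  qed
  moreover have "continuous_on (closure {0..<s}) (\<lambda>u. (?r u)\<^sup>2 - V 0 * (c - ?r u))"
    using \<open>s > 0\<close> by (auto intro!: continuous_intros continuous_on_subset[OF continuous_wnorm_e])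
  moreover have "s \<in> closure {0..<s}" using \<open>s > 0\<close> by simp
  ultimately have "(?r s)\<^sup>2 - V 0 * (c - ?r s) \<le> 0"
    by (rule_tac continuous_le_on_closure)
  moreover have "V 0 * (c - ?r s) \<le> 0"
    using V_nonneg(1)[OF init] s by (simp add: mult_nonneg_nonpos)
  moreover have "(?r s)\<^sup>2 > 0" using s c by simp
  ultimately show False by simp
qed

text \<open>The barrier bound in Euclidean terms. It holds before the regressor is known to be
  bounded, and later serves to bound the regressor itself.\<close>

lemma bounded_e: "bounded (e ` {0..})"
proof -
  obtain m where m: "m > 0" "\<And>u. m * (norm u)\<^sup>2 \<le> u \<bullet> (P *v u)"
    using pos_def_map_bounded_below[OF spd_pos_def_map[OF P]] by metis
  have "norm (e t) \<le> sqrt (c\<^sup>2 / m)" if "t \<ge> 0" for t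
  proof -
    have "m * (norm (e t))\<^sup>2 \<le> (wnorm P (e t))\<^sup>2" using m(2) by (simp add: wnorm_power2[OF P])
    also have "\<dots> \<le> c\<^sup>2"
      using barrier_invariant[OF that] wnorm_nonneg[OF P] by (intro power_mono) auto
    finally show ?thesis using m(1) by (intro real_le_rsqrt) (simp add: field_simps)
  qed
  then show ?thesis by (auto simp: bounded_iff)
qed

text \<open>The gain term of \<open>V\<close> never exceeds \<open>V 0\<close>, and the form of
  \<open>inv G\<close> controls the Euclidean norm.\<close>

lemma bounded_k: "bounded ((\<lambda>t. k t - k_star) ` {0..})"
proof -
  obtain m where m: "m > 0" "\<And>u. m * (norm u)\<^sup>2 \<le> u \<bullet> inv G u"
    using pos_def_map_bounded_below[OF pos_def_map_inv[OF G]] by metis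
  have "norm (k t - k_star) \<le> sqrt (V 0 / (\<theta> * m))" if "t \<ge> 0" for t
  proof -
    have "\<theta> * (m * (norm (k t - k_star))\<^sup>2) \<le> \<theta> * ((k t - k_star) \<bullet> inv G (k t - k_star))"
      using m(2) \<theta> by simp
    also have "\<dots> \<le> V t" using V_nonneg(3) barrier_invariant that by simp
    also have "\<dots> \<le> V 0" using that barrier_invariant by (intro V_le_init) auto
    finally show ?thesis using m(1) \<theta> by (intro real_le_rsqrt) (simp add: field_simps)
  qed
  then show ?thesis by (auto simp: bounded_iff)
qed

theorem e_tendsto_0:
  assumes "bounded (\<phi> ` {0..})"
  shows "(e \<longlongrightarrow> 0) at_top"
proof -
  obtain E where E: "\<And>t. t \<ge> 0 \<Longrightarrow> norm (e t) \<le> E" using bounded_e by (auto simp: bounded_iff)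
  obtain K where K: "\<And>t. t \<ge> 0 \<Longrightarrow> norm (k t - k_star) \<le> K"
    using bounded_k by (auto simp: bounded_iff)
  obtain F where F: "\<And>t. t \<ge> 0 \<Longrightarrow> norm (\<phi> t) \<le> F" using assms by (auto simp: bounded_iff)
  obtain M where M: "M > 0" "\<And>u. norm (A *v u) \<le> norm u * M"
    using bounded_linear.pos_bounded[OF matrix_vector_mul_bounded_linear] by blast
  have nonneg: "E \<ge> 0" "K \<ge> 0" "F \<ge> 0"
    using E[of 0] K[of 0] F[of 0] norm_ge_zero order_trans by (blast intro: order_refl)+
  let ?f = "\<lambda>t. A *v e t + (\<theta> * ((k t - k_star) \<bullet> \<phi> t)) *\<^sub>R b"
  \<comment> \<open>A bound on the derivative of \<open>e\<close>, summand by summand; it becomes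
    the Lipschitz constant.\<close>
  define L where "L = E * M + \<theta> * (K * F) * norm b"
  have L: "norm (?f t) \<le> L" if "t > 0" for t
  proof -
    have "\<bar>(k t - k_star) \<bullet> \<phi> t\<bar> \<le> norm (k t - k_star) * norm (\<phi> t)"
      by (rule Cauchy_Schwarz_ineq2)
    also have "\<dots> \<le> K * F" using K[of t] F[of t] that nonneg by (intro mult_mono) auto
    finally have "norm ((\<theta> * ((k t - k_star) \<bullet> \<phi> t)) *\<^sub>R b) \<le> \<theta> * (K * F) * norm b"
      using \<theta> by (simp add: abs_mult mult_left_mono mult_right_mono)
    moreover have "norm (A *v e t) \<le> E * M"
      using M(2)[of "e t"] E[of t] that M(1)
      by (meson less_imp_le mult_right_mono order_trans)
    ultimately show ?thesis unfolding L_def by (intro norm_triangle_mono)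
  qed
  have "L \<ge> 0" using L[of 1] norm_ge_zero order_trans by (metis zero_less_one)
  have lip: "L-lipschitz_on {0<..} e"
  proof (rule bounded_derivative_imp_lipschitz)
    show "(e has_derivative (\<lambda>s. s *\<^sub>R ?f t)) (at t within {0<..})" if "t \<in> {0<..}" for t
      using solves_has_vector_derivative_at[OF e continuous_rhs_e, of t] that
      by (auto simp: has_vector_derivative_def intro: has_derivative_at_withinI)
    show "onorm (\<lambda>s. s *\<^sub>R ?f t) \<le> L" if "t \<in> {0<..}" for t
      using L[of t] that by (intro onorm_le) (auto simp: mult.commute[of L] intro: mult_left_mono)
  qed (use \<open>L \<ge> 0\<close> in auto)
  obtain m where m: "m > 0" "\<And>u. m * (norm u)\<^sup>2 \<le> u \<bullet> (Q *v u)"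
    using pos_def_map_bounded_below[OF spd_pos_def_map[OF Q]] by metis
  show ?thesis
  proof (rule barbalat_lyapunov[OF _ _ _ _ lip])
    fix t :: real assume t: "t > 0"
    show "(V has_real_derivative - (dpsi c (wnorm P (e t)) * (e t \<bullet> (Q *v e t)))) (at t)"
      using V_has_derivative[of "t + 1" t] barrier_invariant t by (simp add: at_within_Icc_at)
    show "V t \<ge> 0" using V_nonneg(1) barrier_invariant t by simp
    \<comment> \<open>The lower bounds \<open>1 / (2 * c)\<close> for \<open>dpsi\<close> and
      \<open>m\<close> for the form of \<open>Q\<close> multiply to the decay constant
      \<open>m / (2 * c)\<close>.\<close>
    have "1 / (2 * c) * (m * (norm (e t))\<^sup>2) \<le> dpsi c (wnorm P (e t)) * (e t \<bullet> (Q *v e t))"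
      using barrier_invariant[of t] wnorm_nonneg[OF P] t c m
      by (intro mult_mono dpsi_lower_bound order_trans[OF _ dpsi_lower_bound]) auto
    then show "- (dpsi c (wnorm P (e t)) * (e t \<bullet> (Q *v e t))) \<le> - (m / (2 * c)) * (norm (e t))\<^sup>2"
      by simp
  next
    show "m / (2 * c) > 0" using m c by simp
  qed
qed

end

subsection \<open>Leader, followers and reference platoon\<close>

text \<open>A compact initial segment has compact image, and the tail lies in a unit ball around the
  limit.\<close>

lemma bounded_image_atLeast_if_tendsto:
  fixes f :: "real \<Rightarrow> 'a::real_normed_vector"
  assumes "continuous_on {0..} f" "(f \<longlongrightarrow> l) at_top"
  shows "bounded (f ` {0..})"
proof -
  have "\<forall>\<^sub>F t in at_top. dist (f t) l < 1" using assms(2) by (rule tendstoD) simp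
  then obtain T where T: "\<And>t. t \<ge> T \<Longrightarrow> dist (f t) l < 1" by (auto simp: eventually_at_top_linorder)
  have "compact (f ` {0..T})"
    using assms(1) by (intro compact_continuous_image) (auto intro: continuous_on_subset)
  then have "bounded (f ` {0..T} \<union> ball l 1)" by (simp add: compact_imp_bounded)
  moreover have "f ` {0..} \<subseteq> f ` {0..T} \<union> ball l 1"
    using T by (auto simp: dist_commute) (metis atLeastAtMost_iff image_eqI linear)
  ultimately show ?thesis by (rule bounded_subset)
qed

section \<open>Coordinates and ideal matching gains\<close>

lemma vector_4 [simp]:
  "(vector [w, x, y, z] :: 'a::zero^4) $ 1 = w"
  "(vector [w, x, y, z] :: 'a::zero^4) $ 2 = x"
  "(vector [w, x, y, z] :: 'a::zero^4) $ 3 = y"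
  "(vector [w, x, y, z] :: 'a::zero^4) $ 4 = z"
  by (simp_all add: vector_def)

lemma bounded_linear_wsig: "bounded_linear wsig"
  by (intro linear_conv_bounded_linear[THEN iffD1] linearI)
    (simp_all add: wsig_def vec_eq_iff forall_2)

lemma bounded_linear_lead_full: "bounded_linear lead_full"
  by (intro linear_conv_bounded_linear[THEN iffD1] linearI)
    (simp_all add: lead_full_def vec_eq_iff forall_4)

lemma norm_le_norm_lead_full: "norm y \<le> norm (lead_full y)"
  by (simp add: norm_eq_sqrt_inner inner_vec_def sum_3 sum_4 lead_full_def)

text \<open>The two matrices differ only in the third row, the one that \<open>B_u\<close> reaches;
  the witness solves that row for the gain.\<close>

lemma A_veh_matching:
  assumes "\<theta> \<noteq> 0"
  shows "\<exists>k. \<forall>x. A_m h k\<^sub>p k\<^sub>d tau_bar *v x = A_veh h k\<^sub>p k\<^sub>d tau Lam *v x + (\<theta> * (k \<bullet> x)) *\<^sub>R B_u"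
  by (rule exI[of _ "vector [0, 0, (1 / tau - 1 / tau_bar) / \<theta>, (1 / tau_bar - Lam / tau) / \<theta>]"])
    (use assms in \<open>simp add: vec_eq_iff forall_4 matrix_vector_mult_def sum_4 inner_vec_def
      A_m_def A_veh_def B_u_def algebra_simps diff_divide_distrib\<close>)

lemma A_lead_matching:
  assumes "\<theta> \<noteq> 0"
  shows "\<exists>k. \<forall>y. A_m0 h tau_bar *v y = A_lead h tau Lam *v y + (\<theta> * (k \<bullet> y)) *\<^sub>R B_u0"
  by (rule exI[of _ "vector [0, (1 / tau - 1 / tau_bar) / \<theta>, (1 / tau_bar - Lam / tau) / \<theta>]"])
    (use assms in \<open>simp add: vec_eq_iff forall_3 matrix_vector_mult_def sum_3 inner_vec_def
      A_m0_def A_lead_def B_u0_def algebra_simps diff_divide_distrib\<close>)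

text \<open>The first column of \<open>A_m0\<close> vanishes, so \<open>A_m0\<close> is not Hurwitz
  and admits no positive definite Lyapunov pair. Feedback of the tracking error replaces it by
  \<open>A_c\<close> in the error equation.\<close>

lemma A_c_matching:
  assumes "\<theta> \<noteq> 0"
  shows "\<exists>k. \<forall>y. A_c h \<alpha>\<^sub>1 \<alpha>\<^sub>2 \<alpha>\<^sub>3 *v y = A_m0 h tau_bar *v y + (\<theta> * (k \<bullet> y)) *\<^sub>R B_u0"
  by (rule exI[of _ "vector [\<alpha>\<^sub>1 / \<theta>, (\<alpha>\<^sub>2 + 1 / tau_bar) / \<theta>, (\<alpha>\<^sub>3 - 1 / tau_bar) / \<theta>]"])
    (use assms in \<open>simp add: vec_eq_iff forall_3 matrix_vector_mult_def sum_3 inner_vec_def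
      A_m0_def A_c_def B_u0_def algebra_simps diff_divide_distrib add_divide_distrib\<close>)

section \<open>Tracking errors of the individual vehicles\<close>

lemma follower_tracking:
  fixes x x_r k :: "real \<Rightarrow> real^4"
  assumes P: "spd P" and Q: "spd Q"
    and lyap: "transpose (A_m h k\<^sub>p k\<^sub>d tau_bar) ** P + P ** A_m h k\<^sub>p k\<^sub>d tau_bar = - Q"
    and c: "c > 0" and pos: "tau > 0" "Lam > 0" and \<Gamma>: "spd \<Gamma>"
    and x: "solves x (\<lambda>t. A_veh h k\<^sub>p k\<^sub>d tau Lam *v x t + w t
        + (Lam / tau * (k t \<bullet> x t)) *\<^sub>R B_u)"
    and x_r: "solves x_r (\<lambda>t. A_m h k\<^sub>p k\<^sub>d tau_bar *v x_r t + w t)"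
    and k: "solves k (\<lambda>t. - (dpsi c (wnorm P (x t - x_r t)) *\<^sub>R
        (\<Gamma> *v (((x t - x_r t) \<bullet> (P *v B_u)) *\<^sub>R x t))))"
    and init: "wnorm P (x 0 - x_r 0) < c"
    and bdd: "bounded (x_r ` {0..})"
  shows "((\<lambda>t. x t - x_r t) \<longlongrightarrow> 0) at_top"
proof -
  define \<theta> where "\<theta> = Lam / tau"
  have \<theta>: "\<theta> > 0" using pos by (simp add: \<theta>_def)
  obtain k_star where k_star: "\<And>x. A_m h k\<^sub>p k\<^sub>d tau_bar *v x
      = A_veh h k\<^sub>p k\<^sub>d tau Lam *v x + (\<theta> * (k_star \<bullet> x)) *\<^sub>R B_u"
    using A_veh_matching[of \<theta>] \<theta> by (metis less_irrefl)
  interpret barrier_tracking "A_m h k\<^sub>p k\<^sub>d tau_bar" P Q B_u \<theta> c "(*v) \<Gamma>" "\<lambda>t. x t - x_r t" k x k_star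
  proof
    show "solves (\<lambda>t. x t - x_r t) (\<lambda>t. A_m h k\<^sub>p k\<^sub>d tau_bar *v (x t - x_r t)
        + (\<theta> * ((k t - k_star) \<bullet> x t)) *\<^sub>R B_u)"
      by (rule solves_cong[OF solves_diff[OF x x_r]])
        (simp_all add: matrix_vector_mult_diff_distrib k_star[of "x _"] \<theta>_def[symmetric]
          inner_diff_left algebra_simps)
  qed (use assms \<theta> spd_pos_def_map[OF \<Gamma>] solves_continuous_on[OF x] in auto)
  \<comment> \<open>The regressor is \<open>x\<close> itself, written as bounded error plus bounded
    reference state.\<close>
  have "bounded ((\<lambda>t. (x t - x_r t) + x_r t) ` {0..})"
    by (intro bounded_plus_comp bounded_e bdd)
  then show ?thesis by (intro e_tendsto_0) simp
qed

lemma leader_tracking: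
  fixes y y_r k_y k_dy :: "real \<Rightarrow> real^3"
  assumes P: "spd P" and Q: "spd Q"
    and lyap: "transpose (A_c h \<alpha>\<^sub>1 \<alpha>\<^sub>2 \<alpha>\<^sub>3) ** P + P ** A_c h \<alpha>\<^sub>1 \<alpha>\<^sub>2 \<alpha>\<^sub>3 = - Q"
    and c: "c > 0" and pos: "tau > 0" "Lam > 0" and \<Gamma>: "spd \<Gamma>_y" "spd \<Gamma>_dy"
    and y: "solves y (\<lambda>t. A_lead h tau Lam *v y t
        + (Lam / tau * (k_y t \<bullet> y t + k_dy t \<bullet> (y t - y_r t))) *\<^sub>R B_u0 + w t)"
    and y_r: "solves y_r (\<lambda>t. A_m0 h tau_bar *v y_r t + w t)"
    and k_y: "solves k_y (\<lambda>t. - (dpsi c (wnorm P (y t - y_r t)) *\<^sub>R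
        (\<Gamma>_y *v (((y t - y_r t) \<bullet> (P *v B_u0)) *\<^sub>R y t))))"
    and k_dy: "solves k_dy (\<lambda>t. - (dpsi c (wnorm P (y t - y_r t)) *\<^sub>R
        (\<Gamma>_dy *v (((y t - y_r t) \<bullet> (P *v B_u0)) *\<^sub>R (y t - y_r t)))))"
    and init: "wnorm P (y 0 - y_r 0) < c"
    and bdd: "bounded (y_r ` {0..})"
  shows "((\<lambda>t. y t - y_r t) \<longlongrightarrow> 0) at_top"
proof -
  define \<theta> where "\<theta> = Lam / tau"
  have \<theta>: "\<theta> > 0" using pos by (simp add: \<theta>_def)
  obtain k1 where k1: "\<And>y. A_m0 h tau_bar *v y = A_lead h tau Lam *v y + (\<theta> * (k1 \<bullet> y)) *\<^sub>R B_u0"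
    using A_lead_matching[of \<theta>] \<theta> by (metis less_irrefl)
  obtain k2 where k2: "\<And>y. A_c h \<alpha>\<^sub>1 \<alpha>\<^sub>2 \<alpha>\<^sub>3 *v y = A_m0 h tau_bar *v y + (\<theta> * (k2 \<bullet> y)) *\<^sub>R B_u0"
    using A_c_matching[of \<theta>] \<theta> by (metis less_irrefl)
  have cont: "continuous_on {0..} y" "continuous_on {0..} y_r"
    using y y_r by (auto intro: solves_continuous_on)
  interpret barrier_tracking "A_c h \<alpha>\<^sub>1 \<alpha>\<^sub>2 \<alpha>\<^sub>3" P Q B_u0 \<theta> c "\<lambda>(u, v). (\<Gamma>_y *v u, \<Gamma>_dy *v v)"
    "\<lambda>t. y t - y_r t" "\<lambda>t. (k_y t, k_dy t)" "\<lambda>t. (y t, y t - y_r t)" "(k1, k2)"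
  proof
    show "solves (\<lambda>t. y t - y_r t) (\<lambda>t. A_c h \<alpha>\<^sub>1 \<alpha>\<^sub>2 \<alpha>\<^sub>3 *v (y t - y_r t)
        + (\<theta> * (((k_y t, k_dy t) - (k1, k2)) \<bullet> (y t, y t - y_r t))) *\<^sub>R B_u0)"
    proof (rule solves_cong[OF solves_diff[OF y y_r]])
      fix t
      \<comment> \<open>Matching with \<open>k1\<close> is used at \<open>y t\<close> only, since
        the ideal gain must multiply the regressor component \<open>y t\<close>; \<open>k2\<close>
        is matched with the error \<open>y t - y_r t\<close>.\<close>
      have "A_m0 h tau_bar *v (y t - y_r t)
          = A_lead h tau Lam *v y t + (\<theta> * (k1 \<bullet> y t)) *\<^sub>R B_u0 - A_m0 h tau_bar *v y_r t"
        by (simp add: matrix_vector_mult_diff_distrib k1[of "y t"])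
      then show "A_lead h tau Lam *v y t
            + (Lam / tau * (k_y t \<bullet> y t + k_dy t \<bullet> (y t - y_r t))) *\<^sub>R B_u0 + w t
            - (A_m0 h tau_bar *v y_r t + w t)
          = A_c h \<alpha>\<^sub>1 \<alpha>\<^sub>2 \<alpha>\<^sub>3 *v (y t - y_r t)
            + (\<theta> * (((k_y t, k_dy t) - (k1, k2)) \<bullet> (y t, y t - y_r t))) *\<^sub>R B_u0"
        unfolding k2 \<theta>_def[symmetric] by (simp add: inner_diff_left algebra_simps)
    qed simp
    show "solves (\<lambda>t. (k_y t, k_dy t)) (\<lambda>t. - (dpsi c (wnorm P (y t - y_r t)) *\<^sub>R
        (case ((y t - y_r t) \<bullet> (P *v B_u0)) *\<^sub>R (y t, y t - y_r t) of
          (u, v) \<Rightarrow> (\<Gamma>_y *v u, \<Gamma>_dy *v v))))"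
      by (rule solves_cong[OF solves_Pair[OF k_y k_dy]]) simp_all
    show "pos_def_map (\<lambda>(u, v). (\<Gamma>_y *v u, \<Gamma>_dy *v v))"
      by (intro pos_def_map_prod spd_pos_def_map \<Gamma>)
    show "continuous_on {0..} (\<lambda>t. (y t, y t - y_r t))"
      by (intro continuous_intros cont)
  qed (use P Q lyap c \<theta> init in auto)
  have "bounded ((\<lambda>t. (y t - y_r t) + y_r t) ` {0..})"
    by (intro bounded_plus_comp bounded_e bdd)
  then have "bounded ((y ` {0..}) \<times> ((\<lambda>t. y t - y_r t) ` {0..}))"
    by (simp add: bounded_Times bounded_e)
  then show ?thesis by (intro e_tendsto_0) (auto elim: bounded_subset)
qed

text \<open>Both systems share the matrix \<open>A_m\<close>, so their difference is driven only by
  the difference of the preceding vehicles' signals, which vanishes in the limit.\<close>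

lemma reference_tracking:
  fixes x x_v z_r z_v :: "real \<Rightarrow> real^4"
  assumes P: "spd P" and Q: "spd Q"
    and lyap: "transpose (A_m h k\<^sub>p k\<^sub>d tau_bar) ** P + P ** A_m h k\<^sub>p k\<^sub>d tau_bar = - Q"
    and z_r: "solves z_r (\<lambda>t. A_m h k\<^sub>p k\<^sub>d tau_bar *v z_r t + B_w h k\<^sub>d *v wsig (x t))"
    and z_v: "solves z_v (\<lambda>t. A_m h k\<^sub>p k\<^sub>d tau_bar *v z_v t + B_w h k\<^sub>d *v wsig (x_v t))"
    and cont: "continuous_on {0..} x" "continuous_on {0..} x_v"
    and conv: "((\<lambda>t. x t - x_v t) \<longlongrightarrow> 0) at_top"
  shows "((\<lambda>t. z_v t - z_r t) \<longlongrightarrow> 0) at_top"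
proof (rule hurwitz_vanishing_input[OF P Q lyap])
  let ?L = "\<lambda>u. B_w h k\<^sub>d *v wsig u"
  have L: "bounded_linear ?L"
    by (rule bounded_linear_compose[OF matrix_vector_mul_bounded_linear bounded_linear_wsig])
  show "solves (\<lambda>t. z_v t - z_r t) (\<lambda>t. A_m h k\<^sub>p k\<^sub>d tau_bar *v (z_v t - z_r t) + ?L (x_v t - x t))"
    by (rule solves_cong[OF solves_diff[OF z_v z_r]])
      (simp_all add: linear_diff[OF bounded_linear.linear[OF L]] matrix_vector_mult_diff_distrib)
  show "continuous_on {0..} (\<lambda>t. ?L (x_v t - x t))"
    by (intro bounded_linear.continuous_on[OF L] continuous_intros cont)
  have "((\<lambda>t. x_v t - x t) \<longlongrightarrow> 0) at_top" using tendsto_minus[OF conv] by simp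
  then show "((\<lambda>t. ?L (x_v t - x t)) \<longlongrightarrow> 0) at_top" by (rule bounded_linear.tendsto_zero[OF L])
qed

theorem proposition1:
  fixes N :: nat
    and h k\<^sub>p k\<^sub>d tau_bar c \<alpha>\<^sub>1 \<alpha>\<^sub>2 \<alpha>\<^sub>3 :: real
    and tau Lam :: "nat \<Rightarrow> real"
    and u_in :: "real \<Rightarrow> real"
    and x x_r x_v :: "nat \<Rightarrow> real \<Rightarrow> real^4"
    and y y_r y_v :: "real \<Rightarrow> real^3"
    and k_x :: "nat \<Rightarrow> real \<Rightarrow> real^4"
    and k_y k_dy :: "real \<Rightarrow> real^3"
    and \<Gamma> :: "nat \<Rightarrow> real^4^4"
    and \<Gamma>_y \<Gamma>_dy :: "real^3^3"
    and P_m Q_m :: "real^4^4"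
    and P_m0 Q_c :: "real^3^3"
  assumes N: "N \<ge> 1"
    and params: "h > 0" "k\<^sub>p > 0" "k\<^sub>d > 0" "tau_bar > 0" "k\<^sub>d > tau_bar * k\<^sub>p" "c > 0"
    and unknown: "\<forall>j\<le>N. tau j > 0 \<and> Lam j > 0"
    and u_in: "bounded (u_in ` {0..})"
    and lyap_m: "spd P_m" "spd Q_m"
      "transpose (A_m h k\<^sub>p k\<^sub>d tau_bar) ** P_m + P_m ** A_m h k\<^sub>p k\<^sub>d tau_bar = - Q_m"
    and alphas: "\<alpha>\<^sub>1 < 0" "\<alpha>\<^sub>2 < 0"
    and lyap_c: "spd P_m0" "spd Q_c"
      "transpose (A_c h \<alpha>\<^sub>1 \<alpha>\<^sub>2 \<alpha>\<^sub>3) ** P_m0 + P_m0 ** A_c h \<alpha>\<^sub>1 \<alpha>\<^sub>2 \<alpha>\<^sub>3 = - Q_c"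
    and gains: "\<forall>j\<in>{1..N}. spd (\<Gamma> j)" "spd \<Gamma>_y" "spd \<Gamma>_dy"
    and lead_states: "\<forall>t\<ge>0. x 0 t = lead_full (y t)" "\<forall>t\<ge>0. x_r 0 t = lead_full (y_r t)"
      "\<forall>t\<ge>0. x_v 0 t = lead_full (y_v t)"
    and lead_ref: "\<forall>t\<ge>0. y_r t = y_v t"
      "solves y_r (\<lambda>t. A_m0 h tau_bar *v y_r t + u_in t *\<^sub>R B_r0 h)"
    and lead_AP: "solves y (\<lambda>t. A_lead h (tau 0) (Lam 0) *v y t
        + (Lam 0 / tau 0 * (k_y t \<bullet> y t + k_dy t \<bullet> (y t - y_r t))) *\<^sub>R B_u0
        + u_in t *\<^sub>R B_r0 h)"
    and lead_adapt:
      "solves k_y (\<lambda>t. - (dpsi c (wnorm P_m0 (y t - y_r t)) *\<^sub>R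
        (\<Gamma>_y *v (((y t - y_r t) \<bullet> (P_m0 *v B_u0)) *\<^sub>R y t))))"
      "solves k_dy (\<lambda>t. - (dpsi c (wnorm P_m0 (y t - y_r t)) *\<^sub>R
        (\<Gamma>_dy *v (((y t - y_r t) \<bullet> (P_m0 *v B_u0)) *\<^sub>R (y t - y_r t)))))"
    and AP: "\<forall>j\<in>{1..N}. solves (x j) (\<lambda>t. A_veh h k\<^sub>p k\<^sub>d (tau j) (Lam j) *v x j t
        + B_w h k\<^sub>d *v wsig (x (j - 1) t)
        + (Lam j / tau j * (k_x j t \<bullet> x j t)) *\<^sub>R B_u)"
    and RP: "\<forall>j\<in>{1..N}. solves (x_r j) (\<lambda>t. A_m h k\<^sub>p k\<^sub>d tau_bar *v x_r j t
        + B_w h k\<^sub>d *v wsig (x (j - 1) t))"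
    and RP_init: "\<forall>j\<in>{1..N}. x_r j 0 = x_v j 0"
    and VP: "\<forall>j\<in>{1..N}. solves (x_v j) (\<lambda>t. A_m h k\<^sub>p k\<^sub>d tau_bar *v x_v j t
        + B_w h k\<^sub>d *v wsig (x_v (j - 1) t))"
    and adapt: "\<forall>j\<in>{1..N}. solves (k_x j) (\<lambda>t. - (dpsi c (wnorm P_m (x j t - x_r j t)) *\<^sub>R
        (\<Gamma> j *v (((x j t - x_r j t) \<bullet> (P_m *v B_u)) *\<^sub>R x j t))))"
    and init: "\<forall>j\<in>{1..N}. wnorm P_m (x j 0 - x_r j 0) < c" "wnorm P_m0 (y 0 - y_r 0) < c"
    and VP_bounded: "\<forall>j\<le>N. bounded (x_v j ` {0..})"
  shows "((\<lambda>t. stack_norm N (\<lambda>j. x_v j t - x_r j t)) \<longlongrightarrow> 0) at_top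
    \<and> (\<forall>j\<in>{1..N}. ((\<lambda>t. x j t - x_v j t) \<longlongrightarrow> 0) at_top)"
proof -
  \<comment> \<open>The reference leader is the virtual leader, whose full state is bounded by
    assumption.\<close>
  have y_r_bounded: "bounded (y_r ` {0..})"
  proof -
    obtain M where M: "\<And>t. t \<ge> 0 \<Longrightarrow> norm (x_v 0 t) \<le> M"
      using VP_bounded by (fastforce simp: bounded_iff)
    have "norm (y_r t) \<le> M" if "t \<ge> 0" for t
      using norm_le_norm_lead_full[of "y_r t"] M[OF that] that lead_states(3) lead_ref(1) by simp
    then show ?thesis by (auto simp: bounded_iff)
  qed
  have "((\<lambda>t. y t - y_r t) \<longlongrightarrow> 0) at_top"
    by (rule leader_tracking[OF lyap_c \<open>c > 0\<close> _ _ gains(2,3) lead_AP lead_ref(2) lead_adapt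
          init(2) y_r_bounded])
      (use unknown in auto)
  then have "((\<lambda>t. lead_full (y t - y_r t)) \<longlongrightarrow> 0) at_top"
    by (rule bounded_linear.tendsto_zero[OF bounded_linear_lead_full])
  \<comment> \<open>The leader identities are given for \<open>t \<ge> 0\<close> only, so limits are
    transferred along eventual equality.\<close>
  moreover have ev: "\<forall>\<^sub>F t in at_top. (t :: real) \<ge> 0" by (rule eventually_ge_at_top)
  then have "\<forall>\<^sub>F t in at_top. lead_full (y t - y_r t) = x 0 t - x_v 0 t"
    by eventually_elim (use lead_states lead_ref(1) in
      \<open>simp add: linear_diff[OF bounded_linear.linear[OF bounded_linear_lead_full]]\<close>)
  ultimately have leader: "((\<lambda>t. x 0 t - x_v 0 t) \<longlongrightarrow> 0) at_top"
    by (rule Lim_transform_eventually)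
  have "\<forall>\<^sub>F t in at_top. 0 = x_v 0 t - x_r 0 t"
    using ev by eventually_elim (use lead_states lead_ref(1) in simp)
  then have leader_ref: "((\<lambda>t. x_v 0 t - x_r 0 t) \<longlongrightarrow> 0) at_top"
    by (rule Lim_transform_eventually[OF tendsto_const])
  have lead_cont: "continuous_on {0..} f" if "\<forall>t\<ge>0. f t = lead_full (g t)" "continuous_on {0..} g"
    for f :: "real \<Rightarrow> real^4" and g
    by (rule continuous_on_eq[OF bounded_linear.continuous_on[OF bounded_linear_lead_full that(2)]])
      (use that(1) in auto)
  have y_cont: "continuous_on {0..} y" "continuous_on {0..} y_r"
    using lead_AP lead_ref(2) by (auto intro: solves_continuous_on)
  \<comment> \<open>Continuity makes the driving differences continuous and turns convergence into
    boundedness on all of \<open>{0..}\<close>.\<close>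
  have cont: "continuous_on {0..} (x j)" "continuous_on {0..} (x_v j)" "continuous_on {0..} (x_r j)"
    if "j \<le> N" for j
  proof -
    show "continuous_on {0..} (x j)"
      using AP that lead_cont[OF lead_states(1) y_cont(1)]
      by (cases "j = 0") (auto intro!: solves_continuous_on)
    show "continuous_on {0..} (x_v j)"
      using VP that lead_cont[of "x_v 0" y_r] lead_states(3) lead_ref(1) y_cont(2)
      by (cases "j = 0") (auto intro!: solves_continuous_on)
    show "continuous_on {0..} (x_r j)"
      using RP that lead_cont[OF lead_states(2) y_cont(2)]
      by (cases "j = 0") (auto intro!: solves_continuous_on)
  qed
  \<comment> \<open>The second conjunct is carried along because it is the vanishing input for the
    next vehicle in the string.\<close>
  have platoon: "((\<lambda>t. x_v j t - x_r j t) \<longlongrightarrow> 0) at_top \<and> ((\<lambda>t. x j t - x_v j t) \<longlongrightarrow> 0) at_top"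
    if "j \<le> N" for j
    using that
  proof (induction j)
    case 0
    show ?case using leader leader_ref by simp
  next
    case (Suc i)
    let ?j = "Suc i"
    have j: "?j \<in> {1..N}" using Suc.prems by simp
    have z: "((\<lambda>t. x_v ?j t - x_r ?j t) \<longlongrightarrow> 0) at_top"
    proof (rule reference_tracking[OF lyap_m])
      show "solves (x_r ?j) (\<lambda>t. A_m h k\<^sub>p k\<^sub>d tau_bar *v x_r ?j t + B_w h k\<^sub>d *v wsig (x i t))"
        using bspec[OF RP j] by simp
      show "solves (x_v ?j) (\<lambda>t. A_m h k\<^sub>p k\<^sub>d tau_bar *v x_v ?j t + B_w h k\<^sub>d *v wsig (x_v i t))"
        using bspec[OF VP j] by simp
    qed (use Suc cont in auto)
    have "bounded ((\<lambda>t. x_v ?j t - x_r ?j t) ` {0..})"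
      using cont[OF Suc.prems] by (intro bounded_image_atLeast_if_tendsto[OF _ z] continuous_intros)
    \<comment> \<open>Boundedness of the reference state, needed for the adaptive tracking result,
      is recovered from the bounded virtual state and the convergent difference.\<close>
    then have "bounded ((\<lambda>t. x_v ?j t - (x_v ?j t - x_r ?j t)) ` {0..})"
      using VP_bounded Suc.prems by (rule_tac bounded_minus_comp) auto
    then have "bounded (x_r ?j ` {0..})" by simp
    then have "((\<lambda>t. x ?j t - x_r ?j t) \<longlongrightarrow> 0) at_top"
      using j unknown gains(1) init(1) Suc.prems
      by (intro follower_tracking[OF lyap_m \<open>c > 0\<close> _ _ _ bspec[OF AP j] bspec[OF RP j]
            bspec[OF adapt j]]) auto
    \<comment> \<open>Subtracting \<open>x_v - x_r\<close> from \<open>x - x_r\<close> leaves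
      \<open>x - x_v\<close>.\<close>
    from tendsto_diff[OF this z] show ?case using z by simp
  qed
  have "((\<lambda>t. stack_norm N (\<lambda>j. x_v j t - x_r j t)) \<longlongrightarrow> sqrt (\<Sum>j\<le>N. (norm (0 :: real^4))\<^sup>2)) at_top"
    unfolding stack_norm_def L2_set_def by (intro tendsto_intros) (use platoon in auto)
  then show ?thesis using platoon by simp
qed

end
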